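(* The smooth affine variety $(\mathbb{C}^* )^{2n}$, with coordinates $(z_1,\dots,z_n,w_1,\dots,w_n)$, equipped with the algebraic symplectic form $\sum_{j=1}^n\frac{dz_j}{z_j}\wedge\frac{dw_j}{w_j}$ has the algebraic Hamiltonian density property.
   Context: For a smooth affine complex variety $X$ with an algebraic symplectic form $\omega$, an algebraic vector field $V$ is Hamiltonian if $i_V\omega=df$ for some regular function $f$ on $X$; these form the Lie algebra $\mathrm{HVF}^{\mathrm{alg}}_\omega(X)$ under the commutator. A vector field is complete if its flow exists for all complex times from every initial point. $(X,\omega)$ has the algebraic Hamiltonian density property if the Lie algebra generated by the complete algebraic Hamiltonian vector fields on $X$ equals $\mathrm{HVF}^{\mathrm{alg}}_\omega(X)$. Here $n\ge 1$ is an integer. *)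

theory Defs
  imports "HOL-Analysis.Analysis"
begin

text \<open>
  Smooth affine varieties are given here as principal open subsets
  \<open>{x. g x \<noteq> 0}\<close> of affine space \<open>complex^'i\<close>, for a polynomial function \<open>g\<close>; their coordinate
  ring is the localisation of the polynomial ring at \<open>g\<close>. Functions, vector fields and forms are
  total functions on \<open>complex^'i\<close> of which only the values on the variety matter.
\<close>

inductive poly_fun :: "(complex^'i \<Rightarrow> complex) \<Rightarrow> bool" where
  const: "poly_fun (\<lambda>x. c)"
| coord: "poly_fun (\<lambda>x. x $ i)"
| add: "poly_fun p \<Longrightarrow> poly_fun q \<Longrightarrow> poly_fun (\<lambda>x. p x + q x)"
| mult: "poly_fun p \<Longrightarrow> poly_fun q \<Longrightarrow> poly_fun (\<lambda>x. p x * q x)"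

definition principal_open :: "(complex^'i \<Rightarrow> complex) \<Rightarrow> (complex^'i) set" where
  "principal_open g = {x. g x \<noteq> 0}"

definition regular_fun :: "(complex^'i \<Rightarrow> complex) \<Rightarrow> (complex^'i \<Rightarrow> complex) \<Rightarrow> bool" where
  "regular_fun g f \<longleftrightarrow>
     (\<exists>p k. poly_fun p \<and> (\<forall>x\<in>principal_open g. f x = p x / g x ^ k))"

text \<open>The value 0 off the variety makes equality of vector fields on the variety coincide with
  equality of functions, and is preserved by linear combinations and brackets.\<close>

definition alg_vector_field ::
    "(complex^'i \<Rightarrow> complex) \<Rightarrow> (complex^'i \<Rightarrow> complex^'i) \<Rightarrow> bool" where
  "alg_vector_field g V \<longleftrightarrow>
     (\<forall>i. regular_fun g (\<lambda>x. V x $ i)) \<and> (\<forall>x. x \<notin> principal_open g \<longrightarrow> V x = 0)"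

definition partial_deriv :: "'i \<Rightarrow> (complex^'i \<Rightarrow> complex) \<Rightarrow> complex^'i \<Rightarrow> complex" where
  "partial_deriv i f x = deriv (\<lambda>t. f (x + t *s axis i 1)) 0"

definition differential :: "(complex^'i \<Rightarrow> complex) \<Rightarrow> complex^'i \<Rightarrow> complex^'i \<Rightarrow> complex" where
  "differential f x u = (\<Sum>i\<in>UNIV. partial_deriv i f x * u $ i)"

definition lie_bracket ::
    "(complex^'i \<Rightarrow> complex^'i) \<Rightarrow> (complex^'i \<Rightarrow> complex^'i) \<Rightarrow> complex^'i \<Rightarrow> complex^'i" where
  "lie_bracket V W x =
     (\<chi> i. differential (\<lambda>y. W y $ i) x (V x) - differential (\<lambda>y. V y $ i) x (W x))"

text \<open>A 2-form \<open>\<omega>\<close> assigns to a point \<open>x\<close> and tangent vectors \<open>u\<close>, \<open>v\<close> the number \<open>\<omega> x u v\<close>.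
  The third condition is regularity of the coefficients, the fourth is \<open>d\<omega> = 0\<close> in
  coordinates.\<close>

definition alg_symplectic_form ::
    "(complex^'i \<Rightarrow> complex) \<Rightarrow> (complex^'i \<Rightarrow> complex^'i \<Rightarrow> complex^'i \<Rightarrow> complex) \<Rightarrow> bool" where
  "alg_symplectic_form g \<omega> \<longleftrightarrow>
     (\<forall>x\<in>principal_open g. \<forall>u. Vector_Spaces.linear (*s) (*) (\<omega> x u)) \<and>
     (\<forall>x\<in>principal_open g. \<forall>u v. \<omega> x u v = - \<omega> x v u) \<and>
     (\<forall>i j. regular_fun g (\<lambda>x. \<omega> x (axis i 1) (axis j 1))) \<and>
     (\<forall>x\<in>principal_open g. \<forall>i j k.
        partial_deriv i (\<lambda>y. \<omega> y (axis j 1) (axis k 1)) x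
      + partial_deriv j (\<lambda>y. \<omega> y (axis k 1) (axis i 1)) x
      + partial_deriv k (\<lambda>y. \<omega> y (axis i 1) (axis j 1)) x = 0) \<and>
     (\<forall>x\<in>principal_open g. \<forall>u. (\<forall>v. \<omega> x u v = 0) \<longrightarrow> u = 0)"

definition hamiltonian_fields ::
    "(complex^'i \<Rightarrow> complex) \<Rightarrow> (complex^'i \<Rightarrow> complex^'i \<Rightarrow> complex^'i \<Rightarrow> complex)
     \<Rightarrow> (complex^'i \<Rightarrow> complex^'i) set" where
  "hamiltonian_fields g \<omega> =
     {V. alg_vector_field g V \<and>
         (\<exists>f. regular_fun g f \<and> (\<forall>x\<in>principal_open g. \<forall>u. \<omega> x (V x) u = differential f x u))}"

definition complete_field ::
    "(complex^'i \<Rightarrow> complex) \<Rightarrow> (complex^'i \<Rightarrow> complex^'i) \<Rightarrow> bool" where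
  "complete_field g V \<longleftrightarrow>
     (\<forall>x\<in>principal_open g. \<exists>\<phi> :: complex \<Rightarrow> complex^'i.
        \<phi> 0 = x \<and>
        (\<forall>t. \<phi> t \<in> principal_open g \<and>
             (\<forall>i. ((\<lambda>s. \<phi> s $ i) has_field_derivative V (\<phi> t) $ i) (at t))))"

definition lie_subalgebra ::
    "(complex^'i \<Rightarrow> complex) \<Rightarrow> (complex^'i \<Rightarrow> complex^'i) set \<Rightarrow> bool" where
  "lie_subalgebra g L \<longleftrightarrow>
     L \<subseteq> {V. alg_vector_field g V} \<and>
     (\<lambda>x. 0) \<in> L \<and>
     (\<forall>V\<in>L. \<forall>W\<in>L. (\<lambda>x. V x + W x) \<in> L) \<and>
     (\<forall>c. \<forall>V\<in>L. (\<lambda>x. c *s V x) \<in> L) \<and>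
     (\<forall>V\<in>L. \<forall>W\<in>L. lie_bracket V W \<in> L)"

definition alg_hamiltonian_density_property ::
    "(complex^'i \<Rightarrow> complex) \<Rightarrow> (complex^'i \<Rightarrow> complex^'i \<Rightarrow> complex^'i \<Rightarrow> complex) \<Rightarrow> bool" where
  "alg_hamiltonian_density_property g \<omega> \<longleftrightarrow>
     lie_subalgebra g hull {V \<in> hamiltonian_fields g \<omega>. complete_field g V}
       = hamiltonian_fields g \<omega>"

text \<open>The torus is the locus in \<open>complex^('n + 'n)\<close> where the product of all coordinates is nonzero.
  The coordinates are \<open>z j = x $ Inl j\<close> and \<open>w j = x $ Inr j\<close>.\<close>

definition coord_prod :: "complex^'i \<Rightarrow> complex" where
  "coord_prod x = (\<Prod>i\<in>UNIV. x $ i)"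

definition wedge :: "('v \<Rightarrow> complex) \<Rightarrow> ('v \<Rightarrow> complex) \<Rightarrow> 'v \<Rightarrow> 'v \<Rightarrow> complex" where
  "wedge \<alpha> \<beta> u v = \<alpha> u * \<beta> v - \<alpha> v * \<beta> u"

definition dlog_coord :: "'i \<Rightarrow> complex^'i \<Rightarrow> complex^'i \<Rightarrow> complex" where
  "dlog_coord i x u = u $ i / x $ i"

definition torus_form ::
    "complex^('n::finite + 'n) \<Rightarrow> complex^('n::finite + 'n) \<Rightarrow> complex^('n::finite + 'n) \<Rightarrow> complex" where
  "torus_form x u v =
     (\<Sum>j\<in>UNIV. wedge (dlog_coord (Inl j) x) (dlog_coord (Inr j) x) u v)"

lemma principal_open_coord_prod:
  "principal_open (coord_prod :: complex^'i \<Rightarrow> complex) = {x. \<forall>i. x $ i \<noteq> 0}"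
  by (auto simp: principal_open_def coord_prod_def)

lemma poly_fun_prod:
  assumes "finite A" "\<And>a. a \<in> A \<Longrightarrow> poly_fun (p a)"
  shows "poly_fun (\<lambda>x. \<Prod>a\<in>A. p a x)"
  using assms by (induction A rule: finite_induct) (auto intro: poly_fun.intros)

lemma poly_fun_coord_prod: "poly_fun (coord_prod :: complex^'i \<Rightarrow> complex)"
  unfolding coord_prod_def [abs_def] by (intro poly_fun_prod poly_fun.coord) simp

fun torus_coeff :: "'n + 'n \<Rightarrow> 'n + 'n \<Rightarrow> complex" where
  "torus_coeff (Inl a) (Inr b) = (if a = b then 1 else 0)"
| "torus_coeff (Inr a) (Inl b) = (if a = b then -1 else 0)"
| "torus_coeff _ _ = 0"

lemma torus_coeff_swap: "torus_coeff j i = - torus_coeff i j"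
  by (cases i; cases j) auto

lemma torus_coeff_refl [simp]: "torus_coeff i i = 0"
  by (cases i) auto

lemma torus_form_axis:
  fixes x :: "complex^('n::finite + 'n)"
  shows "torus_form x (axis i 1) (axis j 1) = torus_coeff i j / (x $ i * x $ j)"
proof -
  have *: "(\<Sum>k\<in>UNIV. if a = k then f k else 0) = f a" for a :: 'n and f :: "'n \<Rightarrow> complex"
    by simp
  show ?thesis
  proof (cases i; cases j)
    fix a b assume [simp]: "i = Inl a" "j = Inr b"
    have "torus_form x (axis i 1) (axis j 1)
        = (\<Sum>k\<in>UNIV. if a = k then (if a = b then 1 else 0) / (x $ i * x $ j) else 0)"
      unfolding torus_form_def wedge_def dlog_coord_def
      by (intro sum.cong refl) (auto simp: axis_def)
    then show ?thesis by (simp add: *)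
  next
    fix a b assume [simp]: "i = Inr a" "j = Inl b"
    have "torus_form x (axis i 1) (axis j 1)
        = (\<Sum>k\<in>UNIV. if a = k then (if a = b then -1 else 0) / (x $ i * x $ j) else 0)"
      unfolding torus_form_def wedge_def dlog_coord_def
      by (intro sum.cong refl) (auto simp: axis_def)
    then show ?thesis by (simp add: *)
  qed (auto simp: torus_form_def wedge_def dlog_coord_def axis_def)
qed

lemma regular_fun_inverse_coords:
  fixes i j :: "'i :: finite"
  assumes "i \<noteq> j"
  shows "regular_fun coord_prod (\<lambda>x :: complex^'i. c / (x $ i * x $ j))"
  unfolding regular_fun_def
proof (intro exI conjI ballI)
  let ?p = "\<lambda>x :: complex^'i. c * (\<Prod>k\<in>UNIV - {i, j}. x $ k)"
  show "poly_fun ?p"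
    by (intro poly_fun.mult poly_fun.const poly_fun_prod poly_fun.coord) simp
  fix x :: "complex^'i" assume "x \<in> principal_open coord_prod"
  then have nz: "\<And>k. x $ k \<noteq> 0" by (simp add: principal_open_coord_prod)
  have "coord_prod x = (\<Prod>k\<in>{i, j}. x $ k) * (\<Prod>k\<in>UNIV - {i, j}. x $ k)"
    unfolding coord_prod_def by (simp add: prod.subset_diff [of "{i, j}" UNIV] mult.commute)
  then have "coord_prod x = x $ i * x $ j * (\<Prod>k\<in>UNIV - {i, j}. x $ k)"
    using assms by simp
  then show "c / (x $ i * x $ j) = ?p x / coord_prod x ^ 1"
    using nz by simp
qed

lemma partial_deriv_inverse_coords:
  fixes x :: "complex^'i"
  assumes "x $ i \<noteq> 0" "x $ j \<noteq> 0"
  shows "partial_deriv k (\<lambda>y. c / (y $ i * y $ j)) x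
     = - c * ((if k = i then 1 else 0) / x $ i + (if k = j then 1 else 0) / x $ j) / (x $ i * x $ j)"
proof -
  let ?d = "\<lambda>l. if k = l then 1 else 0 :: complex"
  have eq: "(\<lambda>t. c / ((x + t *s axis k 1) $ i * (x + t *s axis k 1) $ j))
      = (\<lambda>t. c / ((x $ i + t * ?d i) * (x $ j + t * ?d j)))"
    by (auto simp: axis_def fun_eq_iff)
  have "((\<lambda>t. c / ((x $ i + t * ?d i) * (x $ j + t * ?d j))) has_field_derivative
      (- c * (?d i / x $ i + ?d j / x $ j) / (x $ i * x $ j))) (at 0)"
    using assms by (auto intro!: derivative_eq_intros simp: field_simps)
  then show ?thesis
    unfolding partial_deriv_def eq by (rule DERIV_imp_deriv)
qed

lemma alg_symplectic_torus_form:
  "alg_symplectic_form coord_prod (torus_form :: complex^('n::finite + 'n) \<Rightarrow> _)"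
  unfolding alg_symplectic_form_def
proof (intro conjI ballI allI impI)
  fix x u v :: "complex^('n + 'n)"
  have add: "torus_form x u (v + w) = torus_form x u v + torus_form x u w" for v w
    by (simp add: torus_form_def wedge_def dlog_coord_def algebra_simps add_divide_distrib
        flip: sum.distrib)
  have scale: "torus_form x u (c *s v) = c * torus_form x u v" for c v
    by (simp add: torus_form_def wedge_def dlog_coord_def algebra_simps sum_distrib_left)
  show "Vector_Spaces.linear (*s) (*) (torus_form x u)"
    by unfold_locales (simp_all add: add scale algebra_simps)
  show "torus_form x u v = - torus_form x v u"
    by (simp add: torus_form_def wedge_def flip: sum_negf)
next
  fix i j :: "'n + 'n"
  show "regular_fun coord_prod (\<lambda>x. torus_form x (axis i 1) (axis j 1))"
  proof (cases "i = j")
    case True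
    then show ?thesis unfolding torus_form_axis regular_fun_def
      by (intro exI [of _ "\<lambda>x. 0"] exI [of _ 0]) (auto intro: poly_fun.const)
  next
    case False
    then show ?thesis unfolding torus_form_axis by (rule regular_fun_inverse_coords)
  qed
next
  fix x :: "complex^('n + 'n)" and i j k
  assume "x \<in> principal_open coord_prod"
  then have nz: "\<And>l. x $ l \<noteq> 0" by (simp add: principal_open_coord_prod)
  show "partial_deriv i (\<lambda>y. torus_form y (axis j 1) (axis k 1)) x
      + partial_deriv j (\<lambda>y. torus_form y (axis k 1) (axis i 1)) x
      + partial_deriv k (\<lambda>y. torus_form y (axis i 1) (axis j 1)) x = 0"
    unfolding torus_form_axis partial_deriv_inverse_coords [OF nz nz]
    using nz torus_coeff_swap [of i j] torus_coeff_swap [of j k] torus_coeff_swap [of i k]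
    by (cases "i = j"; cases "j = k"; cases "i = k") (simp_all add: field_simps)
next
  fix x u :: "complex^('n + 'n)"
  assume "x \<in> principal_open coord_prod" and z: "\<forall>v. torus_form x u v = 0"
  then have nz: "\<And>l. x $ l \<noteq> 0" by (simp add: principal_open_coord_prod)
  have "u $ Inl a = 0" for a
  proof -
    have "torus_form x u (axis (Inr a) 1)
        = (\<Sum>k\<in>UNIV. if a = k then u $ Inl a / (x $ Inl a * x $ Inr a) else 0)"
      unfolding torus_form_def wedge_def dlog_coord_def
      by (intro sum.cong refl) (auto simp: axis_def)
    then show ?thesis using z nz by simp
  qed
  moreover have "u $ Inr a = 0" for a
  proof -
    have "torus_form x u (axis (Inl a) 1)
        = (\<Sum>k\<in>UNIV. if a = k then - u $ Inr a / (x $ Inl a * x $ Inr a) else 0)"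
      unfolding torus_form_def wedge_def dlog_coord_def
      by (intro sum.cong refl) (auto simp: axis_def)
    then show ?thesis using z nz by simp
  qed
  ultimately show "u = 0"
    by (metis vec_eq_iff zero_index sum.exhaust)
qed

end

theory Submission
  imports Defs
begin

text \<open>
  The regular functions on the torus are the Laurent polynomials. Write \<open>x\<^sup>a\<close> for the Laurent
  monomial with exponent vector \<open>a\<close>. In logarithmic coordinates the symplectic form has constant
  coefficients, so the Hamiltonian field of \<open>x\<^sup>a\<close> is \<open>x\<^sup>a\<close> times an invariant field of the torus:
  it is \<open>E a = x\<^sup>a \<Sum>\<^sub>i (J a)\<^sub>i x\<^sub>i \<partial>/\<partial>x\<^sub>i\<close>, where \<open>J\<close> swaps the two halves of \<open>a\<close> with a sign.
  Differentiating \<open>x\<^sup>a\<close> along \<open>E b\<close> gives \<open>\<langle>a, b\<rangle> x\<^sup>a x\<^sup>b\<close>, where \<open>\<langle>a, b\<rangle> = \<Sum>\<^sub>i a\<^sub>i (J b)\<^sub>i\<close>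
  is the standard alternating pairing on the lattice of exponents.

  In particular \<open>x\<^sup>a\<close> is constant along \<open>E a\<close>, because \<open>\<langle>a, a\<rangle> = 0\<close>. So the flow of \<open>E a\<close> is
  \<open>x\<^sub>i \<mapsto> x\<^sub>i exp (t (J a)\<^sub>i x\<^sup>a)\<close>, which exists for all complex \<open>t\<close> and stays in the torus
  (\<open>complete_monomial_field\<close>). A Hamiltonian field depends linearly on its function, and is
  determined by it since the form is nondegenerate; hence the Hamiltonian fields are the linear
  span of the complete fields \<open>E a\<close> (\<open>hamiltonian_fields_eq_span\<close>), and the generated Lie algebra
  contains all of them before any bracket is formed. It contains nothing else because
  \<open>[E a, E b] = \<langle>b, a\<rangle> E (a + b)\<close> (\<open>lie_bracket_monomial_fields\<close>) makes the span a Lie algebra.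
\<close>

section \<open>Partial derivatives\<close>

definition has_partials ::
    "(complex^'i \<Rightarrow> complex) \<Rightarrow> complex^'i \<Rightarrow> ('i \<Rightarrow> complex) \<Rightarrow> bool" where
  "has_partials f x D \<longleftrightarrow>
     (\<forall>i. ((\<lambda>t. f (x + t *s axis i 1)) has_field_derivative D i) (at 0))"

lemma differential_eq:
  assumes "has_partials f x D"
  shows "differential f x u = (\<Sum>i\<in>UNIV. D i * u $ i)"
proof -
  have "partial_deriv i f x = D i" for i
    using assms unfolding has_partials_def partial_deriv_def by (blast intro: DERIV_imp_deriv)
  then show ?thesis by (simp add: differential_def)
qed

lemma has_partials_add:
  assumes "has_partials f x D" "has_partials g x D'"
  shows "has_partials (\<lambda>y. f y + g y) x (\<lambda>i. D i + D' i)"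
  using assms by (auto simp: has_partials_def intro!: DERIV_add)

lemma has_partials_mult:
  assumes "has_partials f x D" "has_partials g x D'"
  shows "has_partials (\<lambda>y. f y * g y) x (\<lambda>i. D i * g x + f x * D' i)"
  unfolding has_partials_def
proof
  fix i
  from assms show "((\<lambda>t. f (x + t *s axis i 1) * g (x + t *s axis i 1))
      has_field_derivative D i * g x + f x * D' i) (at 0)"
    unfolding has_partials_def by (auto intro!: derivative_eq_intros)
qed

lemma has_partials_const: "has_partials (\<lambda>y. c) x (\<lambda>i. 0)"
  by (simp add: has_partials_def)

lemma has_partials_coord:
  "has_partials (\<lambda>y. y $ k) x (\<lambda>i. if i = k then 1 else 0)"
  unfolding has_partials_def by (auto intro!: derivative_eq_intros simp: axis_def)

abbreviation torus :: "(complex^'i) set" where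
  "torus \<equiv> principal_open coord_prod"

lemma torus_iff: "x \<in> torus \<longleftrightarrow> (\<forall>i. x $ i \<noteq> 0)"
  by (simp add: principal_open_coord_prod)

text \<open>Functions and fields are determined by their values on the torus only. Because the torus is
  open, those values still determine the partial derivatives at its points.\<close>

lemma eventually_line_torus:
  fixes x :: "complex^'i"
  assumes "x \<in> torus"
  shows "\<forall>\<^sub>F t in nhds 0. x + t *s axis i 1 \<in> torus"
proof -
  have "\<forall>\<^sub>F t in nhds 0. x $ k + t * axis i 1 $ k \<noteq> 0" for k
  proof -
    have "((\<lambda>t. x $ k + t * axis i 1 $ k) \<longlongrightarrow> x $ k + 0 * axis i 1 $ k) (nhds 0)"
      by (intro tendsto_intros filterlim_ident)
    moreover have "x $ k \<noteq> 0" using assms unfolding torus_iff by blast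
    ultimately show ?thesis
      using tendsto_imp_eventually_ne by fastforce
  qed
  then show ?thesis
    by (simp add: torus_iff eventually_all_finite)
qed

lemma has_partials_cong_torus:
  assumes "has_partials f x D" "x \<in> torus" "\<And>y. y \<in> torus \<Longrightarrow> g y = f y"
  shows "has_partials g x D"
  unfolding has_partials_def
proof
  fix i
  have "\<forall>\<^sub>F t in nhds 0. f (x + t *s axis i 1) = g (x + t *s axis i 1)"
    using eventually_line_torus [OF assms(2), of i]
    by eventually_elim (simp add: assms(3))
  from DERIV_cong_ev [OF refl this refl, of "D i"]
  show "((\<lambda>t. g (x + t *s axis i 1)) has_field_derivative D i) (at 0)"
    using assms(1) unfolding has_partials_def by blast
qed

section \<open>Laurent monomials and Laurent polynomials\<close>

definition monomial :: "('i \<Rightarrow> int) \<Rightarrow> complex^'i \<Rightarrow> complex" where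
  "monomial a x = (\<Prod>i\<in>UNIV. x $ i powi a i)"

lemma monomial_add:
  assumes "x \<in> torus"
  shows "monomial (\<lambda>i. a i + b i) x = monomial a x * monomial b x"
  using assms by (simp add: monomial_def torus_iff power_int_add prod.distrib)

lemma has_partials_monomial:
  fixes x :: "complex^'i"
  assumes "x \<in> torus"
  shows "has_partials (monomial a) x (\<lambda>i. of_int (a i) / x $ i * monomial a x)"
  unfolding has_partials_def
proof
  fix i
  let ?c = "\<Prod>k\<in>UNIV - {i}. x $ k powi a k"
  have nz: "x $ i \<noteq> 0" using assms by (simp add: torus_iff)
  have split: "monomial a y = y $ i powi a i * (\<Prod>k\<in>UNIV - {i}. y $ k powi a k)" for y
    unfolding monomial_def by (rule prod.remove) auto
  have line: "monomial a (x + t *s axis i 1) = (x $ i + t) powi a i * ?c" for t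
    unfolding split by (simp add: axis_def)
  have "((\<lambda>t. (x $ i + t) powi a i * ?c) has_field_derivative
      of_int (a i) * x $ i powi (a i - 1) * ?c) (at 0)"
    using nz by (auto intro!: derivative_eq_intros)
  moreover have "of_int (a i) * x $ i powi (a i - 1) * ?c = of_int (a i) / x $ i * monomial a x"
    using nz by (simp add: split power_int_diff)
  ultimately show "((\<lambda>t. monomial a (x + t *s axis i 1)) has_field_derivative
      of_int (a i) / x $ i * monomial a x) (at 0)"
    by (simp add: line)
qed

text \<open>Both rules ask for agreement on the torus only: there a monomial with negative exponents is
  the intended function, whereas off the torus its value is an artefact of \<open>inverse 0 = 0\<close>.\<close>

inductive laurent :: "(complex^'i \<Rightarrow> complex) \<Rightarrow> bool" where
  monom: "(\<And>x. x \<in> torus \<Longrightarrow> f x = c * monomial a x) \<Longrightarrow> laurent f"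
| add: "laurent f \<Longrightarrow> laurent g \<Longrightarrow> (\<And>x. x \<in> torus \<Longrightarrow> h x = f x + g x) \<Longrightarrow> laurent h"

lemma laurent_monomial_mult:
  assumes "laurent f" "\<And>x. x \<in> torus \<Longrightarrow> h x = c * monomial a x * f x"
  shows "laurent h"
  using assms
proof (induction arbitrary: h rule: laurent.induct)
  case (monom f d b)
  show ?case
    by (rule laurent.monom [of _ "c * d" "\<lambda>i. a i + b i"])
      (simp add: monom monomial_add)
next
  case (add f g k)
  show ?case
    by (rule laurent.add [OF add.IH(1) [OF refl] add.IH(2) [OF refl]])
      (simp add: add.hyps add.prems algebra_simps)
qed

lemma laurent_mult:
  assumes "laurent f" "laurent g" "\<And>x. x \<in> torus \<Longrightarrow> h x = f x * g x"
  shows "laurent h"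
  using assms
proof (induction arbitrary: h rule: laurent.induct)
  case (monom f c a)
  then show ?case by (auto intro: laurent_monomial_mult)
next
  case (add f f' k)
  show ?case
    by (rule laurent.add [OF add.IH(1) [OF add.prems(1) refl] add.IH(2) [OF add.prems(1) refl]])
      (simp add: add.hyps add.prems algebra_simps)
qed

lemma poly_fun_laurent: "poly_fun p \<Longrightarrow> laurent p"
proof (induction rule: poly_fun.induct)
  case (const c)
  show ?case by (rule laurent.monom [of _ c "\<lambda>i. 0"]) (simp add: monomial_def)
next
  case (coord i)
  have "monomial (\<lambda>k. if k = i then 1 else 0) x = x $ i" for x :: "complex^'a"
    unfolding monomial_def by (subst prod.remove [of _ i]) auto
  then show ?case by (metis laurent.monom mult_1)
qed (auto intro: laurent.add laurent_mult)

text \<open>The function inverted in the coordinate ring is itself a monomial, so dividing by its powers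
  only shifts exponents.\<close>

lemma regular_imp_laurent:
  assumes "regular_fun coord_prod f"
  shows "laurent f"
proof -
  from assms obtain p k where p: "poly_fun p" and f: "\<And>x. x \<in> torus \<Longrightarrow> f x = p x / coord_prod x ^ k"
    unfolding regular_fun_def by blast
  have "monomial (\<lambda>i. - int k) x = inverse (coord_prod x ^ k)" for x :: "complex^'a"
    by (simp add: monomial_def coord_prod_def power_int_minus inverse_eq_divide prod_dividef prod_power_distrib)
  then show ?thesis
    by (intro laurent_monomial_mult [OF poly_fun_laurent [OF p], of _ 1 "\<lambda>i. - int k"])
      (simp add: f divide_inverse)
qed

lemma regular_fun_add:
  assumes g: "poly_fun g" and "regular_fun g f" "regular_fun g f'"
  shows "regular_fun g (\<lambda>x. f x + f' x)"
proof -
  have pow: "poly_fun (\<lambda>x. g x ^ k)" for k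
    by (induction k) (auto intro: poly_fun.intros g)
  from assms obtain p k q l where
    p: "poly_fun p" "\<And>x. x \<in> principal_open g \<Longrightarrow> f x = p x / g x ^ k" and
    q: "poly_fun q" "\<And>x. x \<in> principal_open g \<Longrightarrow> f' x = q x / g x ^ l"
    unfolding regular_fun_def by blast
  show ?thesis
    unfolding regular_fun_def
  proof (intro exI conjI ballI)
    show "poly_fun (\<lambda>x. p x * g x ^ l + q x * g x ^ k)"
      by (intro poly_fun.add poly_fun.mult p q pow)
    fix x assume "x \<in> principal_open g"
    then show "f x + f' x = (p x * g x ^ l + q x * g x ^ k) / g x ^ (k + l)"
      using p(2) q(2) by (simp add: principal_open_def field_simps power_add)
  qed
qed

text \<open>Multiplying by a power of the product of all coordinates that exceeds every negative exponent
  clears the denominators of a monomial; the sum of the absolute values of the exponents is such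
  a power.\<close>

lemma regular_fun_monomial:
  "regular_fun coord_prod (\<lambda>x :: complex^'i. c * monomial a x)"
proof -
  define k where "k = nat (\<Sum>i\<in>UNIV. \<bar>a i\<bar>)"
  have k: "int k + a i \<ge> 0" for i
  proof -
    have "\<bar>a i\<bar> \<le> (\<Sum>i\<in>UNIV. \<bar>a i\<bar>)" by (rule member_le_sum) auto
    then show ?thesis unfolding k_def by linarith
  qed
  have pow: "poly_fun (\<lambda>x :: complex^'i. x $ i ^ m)" for i m
    by (induction m) (auto intro: poly_fun.intros)
  show ?thesis
    unfolding regular_fun_def
  proof (intro exI conjI ballI)
    show "poly_fun (\<lambda>x :: complex^'i. c * (\<Prod>i\<in>UNIV. x $ i ^ nat (int k + a i)))"
      by (intro poly_fun.mult poly_fun.const poly_fun_prod pow) simp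
    fix x :: "complex^'i" assume x: "x \<in> torus"
    have "x $ i ^ nat (int k + a i) = x $ i ^ k * x $ i powi a i" for i
    proof -
      have "x $ i ^ nat (int k + a i) = x $ i powi (int k + a i)"
        using k [of i] by (simp add: power_int_def)
      then show ?thesis using x by (simp add: torus_iff power_int_add)
    qed
    then have "(\<Prod>i\<in>UNIV. x $ i ^ nat (int k + a i)) = coord_prod x ^ k * monomial a x"
      by (simp add: prod.distrib monomial_def coord_prod_def prod_power_distrib)
    then show "c * monomial a x = c * (\<Prod>i\<in>UNIV. x $ i ^ nat (int k + a i)) / coord_prod x ^ k"
      using x by (simp add: principal_open_def)
  qed
qed

lemma regular_fun_cong:
  assumes "regular_fun g f" "\<And>x. x \<in> principal_open g \<Longrightarrow> f' x = f x"
  shows "regular_fun g f'"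
  using assms unfolding regular_fun_def by simp

lemma laurent_imp_regular: "laurent f \<Longrightarrow> regular_fun coord_prod f"
proof (induction rule: laurent.induct)
  case (monom f c a)
  then show ?case by (rule regular_fun_cong [OF regular_fun_monomial])
next
  case (add f g h)
  then show ?case by (blast intro: regular_fun_cong regular_fun_add poly_fun_coord_prod)
qed

lemma laurent_has_partials:
  assumes "laurent f" "x \<in> torus"
  shows "\<exists>D. has_partials f x D"
  using assms
proof (induction rule: laurent.induct)
  case (monom f c a)
  have "has_partials (\<lambda>y. c * monomial a y) x
      (\<lambda>i. 0 * monomial a x + c * (of_int (a i) / x $ i * monomial a x))"
    by (intro has_partials_mult has_partials_const has_partials_monomial monom.prems)
  then show ?case using monom has_partials_cong_torus by blast
next
  case (add f g h)
  then show ?case by (blast intro: has_partials_cong_torus has_partials_add)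
qed

lemma differential_laurent_add:
  assumes "laurent f" "laurent g" "x \<in> torus" "\<And>y. y \<in> torus \<Longrightarrow> h y = f y + g y"
  shows "differential h x u = differential f x u + differential g x u"
proof -
  obtain D D' where *: "has_partials f x D" "has_partials g x D'"
    using assms laurent_has_partials by blast
  have "has_partials h x (\<lambda>i. D i + D' i)"
    by (rule has_partials_cong_torus [OF has_partials_add [OF *] assms(3,4)])
  then show ?thesis
    by (simp add: differential_eq [OF *(1)] differential_eq [OF *(2)] differential_eq
        distrib_right sum.distrib)
qed

section \<open>Hamiltonian fields of monomials\<close>

text \<open>This is the lattice version of the isomorphism that the symplectic form induces between
  covectors and vectors: it takes the logarithmic differential of \<open>x\<^sup>a\<close>, whose coefficients are
  \<open>a\<close>, to the invariant field whose coefficients are \<open>dual_exponent a\<close>.\<close>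

fun dual_exponent :: "('n + 'n \<Rightarrow> int) \<Rightarrow> 'n + 'n \<Rightarrow> int" where
  "dual_exponent a (Inl j) = a (Inr j)"
| "dual_exponent a (Inr j) = - a (Inl j)"

definition pairing :: "('n::finite + 'n \<Rightarrow> int) \<Rightarrow> ('n + 'n \<Rightarrow> int) \<Rightarrow> int" where
  "pairing a b = (\<Sum>i\<in>UNIV. a i * dual_exponent b i)"

lemma sum_UNIV_Plus:
  "(\<Sum>i\<in>UNIV. f i) = (\<Sum>j\<in>UNIV. f (Inl j) + f (Inr j))"
  for f :: "'n::finite + 'n \<Rightarrow> 'b::comm_monoid_add"
  by (simp add: UNIV_Plus_UNIV [symmetric] sum.Plus sum.distrib del: UNIV_Plus_UNIV)

lemma pairing_swap: "pairing b a = - pairing a b"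
  by (simp add: pairing_def sum_UNIV_Plus algebra_simps flip: sum_negf)

lemma pairing_self: "pairing a a = 0"
  using pairing_swap [of a a] by simp

definition monomial_field :: "('n::finite + 'n \<Rightarrow> int) \<Rightarrow> complex^('n + 'n) \<Rightarrow> complex^('n + 'n)" where
  "monomial_field a x =
     (if x \<in> torus then (\<chi> i. of_int (dual_exponent a i) * (x $ i * monomial a x)) else 0)"

text \<open>The zero field is the case \<open>c = 0\<close> of the first rule.\<close>

inductive monomial_span :: "(complex^('n::finite + 'n) \<Rightarrow> complex^('n + 'n)) \<Rightarrow> bool" where
  scaled: "monomial_span (\<lambda>x. c *s monomial_field a x)"
| add: "monomial_span V \<Longrightarrow> monomial_span W \<Longrightarrow> monomial_span (\<lambda>x. V x + W x)"

lemma monomial_span_scale: "monomial_span V \<Longrightarrow> monomial_span (\<lambda>x. c *s V x)"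
proof (induction rule: monomial_span.induct)
  case (scaled d a)
  show ?case using monomial_span.scaled [of "c * d" a] by (simp add: vector_smult_assoc)
next
  case (add V W)
  then show ?case using monomial_span.add by (fastforce simp: vector_add_ldistrib)
qed

lemma monomial_span_off_torus: "monomial_span V \<Longrightarrow> x \<notin> torus \<Longrightarrow> V x = 0"
  by (induction rule: monomial_span.induct) (simp_all add: monomial_field_def)

lemma monomial_span_component_laurent: "monomial_span V \<Longrightarrow> laurent (\<lambda>x. V x $ i)"
proof (induction rule: monomial_span.induct)
  case (scaled c a)
  have "laurent (\<lambda>x. x $ i)" by (intro poly_fun_laurent poly_fun.coord)
  then show ?case
    by (rule laurent_monomial_mult [where c = "c * of_int (dual_exponent a i)" and a = a])
      (simp add: monomial_field_def mult_ac)
next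
  case (add V W)
  then show ?case by (auto intro: laurent.add)
qed

lemma monomial_span_alg_vector_field: "monomial_span V \<Longrightarrow> alg_vector_field coord_prod V"
  unfolding alg_vector_field_def
  by (intro conjI allI impI laurent_imp_regular monomial_span_component_laurent
      monomial_span_off_torus)

lemma torus_form_monomial_field:
  fixes x :: "complex^('n::finite + 'n)"
  assumes "x \<in> torus"
  shows "torus_form x (monomial_field a x) u = differential (monomial a) x u"
  unfolding differential_eq [OF has_partials_monomial [OF assms]] torus_form_def sum_UNIV_Plus
  using assms
  by (intro sum.cong refl)
    (simp add: monomial_field_def wedge_def dlog_coord_def torus_iff field_simps)

lemma torus_form_add_left:
  "torus_form x (v + w) u = torus_form x v u + torus_form x w u"
  by (simp add: torus_form_def wedge_def dlog_coord_def algebra_simps add_divide_distrib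
      flip: sum.distrib)

lemma torus_form_scale_left: "torus_form x (c *s v) u = c * torus_form x v u"
  by (simp add: torus_form_def wedge_def dlog_coord_def algebra_simps sum_distrib_left)

definition has_hamiltonian ::
    "(complex^('n::finite + 'n) \<Rightarrow> complex^('n + 'n)) \<Rightarrow> (complex^('n + 'n) \<Rightarrow> complex) \<Rightarrow> bool" where
  "has_hamiltonian V f \<longleftrightarrow> (\<forall>x\<in>torus. \<forall>u. torus_form x (V x) u = differential f x u)"

lemma has_hamiltonian_monomial:
  assumes "\<And>x. x \<in> torus \<Longrightarrow> f x = c * monomial a x"
  shows "has_hamiltonian (\<lambda>x. c *s monomial_field a x) f"
  unfolding has_hamiltonian_def
proof (intro ballI allI)
  fix x u :: "complex^('a + 'a)" assume x: "x \<in> torus"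
  have "has_partials (\<lambda>y. c * monomial a y) x
      (\<lambda>i. 0 * monomial a x + c * (of_int (a i) / x $ i * monomial a x))"
    by (intro has_partials_mult has_partials_const has_partials_monomial x)
  then have "has_partials f x
      (\<lambda>i. 0 * monomial a x + c * (of_int (a i) / x $ i * monomial a x))"
    using assms x has_partials_cong_torus by blast
  then show "torus_form x (c *s monomial_field a x) u = differential f x u"
    by (simp add: torus_form_scale_left torus_form_monomial_field x differential_eq
        differential_eq [OF has_partials_monomial [OF x]] sum_distrib_left mult_ac)
qed

lemma has_hamiltonian_add:
  assumes "has_hamiltonian V f" "has_hamiltonian W g" "laurent f" "laurent g"
    and "\<And>x. x \<in> torus \<Longrightarrow> h x = f x + g x"
  shows "has_hamiltonian (\<lambda>x. V x + W x) h"
  using assms unfolding has_hamiltonian_def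
  by (simp add: torus_form_add_left differential_laurent_add)

lemma monomial_span_has_hamiltonian:
  "monomial_span V \<Longrightarrow> \<exists>f. laurent f \<and> has_hamiltonian V f"
proof (induction rule: monomial_span.induct)
  case (scaled c a)
  show ?case
    by (intro exI conjI, rule laurent.monom [OF refl], rule has_hamiltonian_monomial [OF refl])
next
  case (add V W)
  then obtain f g where "laurent f" "has_hamiltonian V f" "laurent g" "has_hamiltonian W g"
    by blast
  then have "laurent (\<lambda>x. f x + g x) \<and> has_hamiltonian (\<lambda>x. V x + W x) (\<lambda>x. f x + g x)"
    using laurent.add [OF _ _ refl] has_hamiltonian_add [OF _ _ _ _ refl] by metis
  then show ?case by blast
qed

lemma laurent_has_monomial_span_field:
  "laurent f \<Longrightarrow> \<exists>V. monomial_span V \<and> has_hamiltonian V f"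
proof (induction rule: laurent.induct)
  case (monom f c a)
  then show ?case using has_hamiltonian_monomial monomial_span.scaled by blast
next
  case (add f g h)
  then show ?case by (blast intro: has_hamiltonian_add monomial_span.add)
qed

lemma field_of_hamiltonian_unique:
  assumes "has_hamiltonian V f" "has_hamiltonian W f" "x \<in> torus"
  shows "V x = W x"
proof -
  have "torus_form x (V x + (-1) *s W x) u = 0" for u
    using assms unfolding has_hamiltonian_def
    by (simp only: torus_form_add_left torus_form_scale_left) simp
  then have "V x + (-1) *s W x = 0"
    using alg_symplectic_torus_form assms(3) unfolding alg_symplectic_form_def by blast
  then show ?thesis by simp
qed

text \<open>A Hamiltonian function is a Laurent polynomial, hence also a Hamiltonian function of some
  combination of monomial fields; nondegeneracy of the form identifies this combination with the
  given field.\<close>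

lemma hamiltonian_fields_eq_span:
  "hamiltonian_fields coord_prod (torus_form :: complex^('n::finite + 'n) \<Rightarrow> _)
     = {V. monomial_span V}"
proof (intro set_eqI iffI CollectI)
  fix V :: "complex^('n + 'n) \<Rightarrow> complex^('n + 'n)"
  assume V: "V \<in> hamiltonian_fields coord_prod torus_form"
  then obtain f where "regular_fun coord_prod f" and f: "has_hamiltonian V f"
    unfolding hamiltonian_fields_def has_hamiltonian_def by blast
  then obtain W where W: "monomial_span W" "has_hamiltonian W f"
    using laurent_has_monomial_span_field regular_imp_laurent by blast
  have "V x = W x" for x
  proof (cases "x \<in> torus")
    case True
    then show ?thesis using f W field_of_hamiltonian_unique by blast
  next
    case False
    then show ?thesis
      using V monomial_span_off_torus [OF W(1)]
      by (simp add: hamiltonian_fields_def alg_vector_field_def)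
  qed
  with W show "monomial_span V" by (metis ext)
next
  fix V :: "complex^('n + 'n) \<Rightarrow> complex^('n + 'n)"
  assume "V \<in> {V. monomial_span V}"
  then have V: "monomial_span V" by simp
  then show "V \<in> hamiltonian_fields coord_prod torus_form"
    using monomial_span_has_hamiltonian [OF V] monomial_span_alg_vector_field [OF V]
    unfolding hamiltonian_fields_def has_hamiltonian_def
    by (blast intro: laurent_imp_regular)
qed

section \<open>Brackets\<close>

text \<open>The component is a multiple of \<open>x\<^sub>i x\<^sup>a\<close>. Along \<open>E b\<close>, the factor \<open>x\<^sub>i\<close> contributes
  \<open>(J b)\<^sub>i\<close> and the factor \<open>x\<^sup>a\<close> contributes \<open>\<langle>a, b\<rangle>\<close>, both times \<open>x\<^sup>b\<close>.\<close>

lemma differential_monomial_field: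
  fixes x :: "complex^('n::finite + 'n)"
  assumes "x \<in> torus"
  shows "differential (\<lambda>y. (c *s monomial_field a y) $ i) x (d *s monomial_field b x)
    = c * d * of_int (dual_exponent a i) * (of_int (dual_exponent b i) + of_int (pairing a b))
        * (x $ i * monomial a x * monomial b x)"
proof -
  let ?C = "c * of_int (dual_exponent a i)"
  let ?D = "\<lambda>k. 0 * (x $ i * monomial a x) + ?C *
    ((if k = i then 1 else 0) * monomial a x + x $ i * (of_int (a k) / x $ k * monomial a x))"
  have "has_partials (\<lambda>y. ?C * (y $ i * monomial a y)) x ?D"
    by (intro has_partials_mult has_partials_const has_partials_coord has_partials_monomial assms)
  then have D: "has_partials (\<lambda>y. (c *s monomial_field a y) $ i) x ?D"
    by (rule has_partials_cong_torus [OF _ assms]) (simp add: monomial_field_def)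
  have "?D k * (d *s monomial_field b x) $ k
      = ?C * d * (x $ i * monomial a x * monomial b x) *
        ((if k = i then of_int (dual_exponent b k) else 0) + of_int (a k * dual_exponent b k))" for k
    using assms by (simp add: monomial_field_def torus_iff field_simps)
  then have "differential (\<lambda>y. (c *s monomial_field a y) $ i) x (d *s monomial_field b x)
      = ?C * d * (x $ i * monomial a x * monomial b x) *
        (\<Sum>k\<in>UNIV. (if k = i then of_int (dual_exponent b k) else 0) + of_int (a k * dual_exponent b k))"
    unfolding differential_eq [OF D] by (simp only: sum_distrib_left)
  also have "(\<Sum>k\<in>UNIV. (if k = i then of_int (dual_exponent b k) else 0)
        + of_int (a k * dual_exponent b k))
      = (of_int (dual_exponent b i) + of_int (pairing a b) :: complex)"
    by (simp only: sum.distrib pairing_def of_int_sum) simp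
  finally show ?thesis by (simp add: mult_ac)
qed

text \<open>In the difference of the two derivatives the terms \<open>(J a)\<^sub>i (J b)\<^sub>i\<close> cancel, and
  \<open>\<langle>a, b\<rangle> = - \<langle>b, a\<rangle>\<close> combines the remaining ones into \<open>\<langle>b, a\<rangle> ((J a)\<^sub>i + (J b)\<^sub>i)\<close>.\<close>

lemma lie_bracket_monomial_fields:
  "lie_bracket (\<lambda>x. c *s monomial_field a x) (\<lambda>x. d *s monomial_field b x)
     = (\<lambda>x. (c * d * of_int (pairing b a)) *s monomial_field (\<lambda>i. a i + b i) x)"
proof (rule ext, cases)
  fix x :: "complex^('a + 'a)" assume x: "x \<in> torus"
  have dual: "dual_exponent (\<lambda>i. a i + b i) i = dual_exponent a i + dual_exponent b i" for i
    by (cases i) auto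
  have "lie_bracket (\<lambda>x. c *s monomial_field a x) (\<lambda>x. d *s monomial_field b x) x $ i
     = ((c * d * of_int (pairing b a)) *s monomial_field (\<lambda>i. a i + b i) x) $ i" for i
    unfolding lie_bracket_def vec_lambda_beta differential_monomial_field [OF x]
    using x by (simp add: monomial_field_def monomial_add dual pairing_swap [of a b] algebra_simps)
  then show "lie_bracket (\<lambda>x. c *s monomial_field a x) (\<lambda>x. d *s monomial_field b x) x
     = (c * d * of_int (pairing b a)) *s monomial_field (\<lambda>i. a i + b i) x"
    by (simp add: vec_eq_iff)
next
  fix x :: "complex^('a + 'a)" assume "x \<notin> torus"
  then show "lie_bracket (\<lambda>x. c *s monomial_field a x) (\<lambda>x. d *s monomial_field b x) x
     = (c * d * of_int (pairing b a)) *s monomial_field (\<lambda>i. a i + b i) x"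
    by (simp add: lie_bracket_def monomial_field_def differential_def vec_eq_iff)
qed

lemma lie_bracket_swap: "lie_bracket V W = (\<lambda>x. (-1) *s lie_bracket W V x)"
  by (auto simp: lie_bracket_def vec_eq_iff)

lemma lie_bracket_add_right:
  fixes U V W :: "complex^('n::finite + 'n) \<Rightarrow> complex^('n + 'n)"
  assumes "monomial_span U" "monomial_span V" "monomial_span W"
  shows "lie_bracket U (\<lambda>x. V x + W x) = (\<lambda>x. lie_bracket U V x + lie_bracket U W x)"
proof (rule ext, cases)
  fix x :: "complex^('n + 'n)" assume x: "x \<in> torus"
  have "differential (\<lambda>y. (V y + W y) $ i) x u
      = differential (\<lambda>y. V y $ i) x u + differential (\<lambda>y. W y $ i) x u" for i u
    using assms x by (intro differential_laurent_add monomial_span_component_laurent) auto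
  moreover have "differential f x (V x + W x) = differential f x (V x) + differential f x (W x)" for f
    by (simp add: differential_def distrib_left sum.distrib)
  ultimately show "lie_bracket U (\<lambda>x. V x + W x) x = lie_bracket U V x + lie_bracket U W x"
    by (simp add: lie_bracket_def vec_eq_iff)
next
  fix x :: "complex^('n + 'n)" assume "x \<notin> torus"
  then show "lie_bracket U (\<lambda>x. V x + W x) x = lie_bracket U V x + lie_bracket U W x"
    using assms by (simp add: lie_bracket_def monomial_span_off_torus differential_def vec_eq_iff)
qed

lemma monomial_span_bracket:
  assumes "monomial_span V" "monomial_span W"
  shows "monomial_span (lie_bracket V W)"
proof -
  have gen: "monomial_span (lie_bracket (\<lambda>x. c *s monomial_field a x) W)"
    if "monomial_span W" for c a and W :: "complex^('a + 'a) \<Rightarrow> _"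
    using that
  proof (induction rule: monomial_span.induct)
    case (scaled d b)
    show ?case unfolding lie_bracket_monomial_fields by (rule monomial_span.scaled)
  next
    case (add V W)
    then show ?case
      by (simp add: lie_bracket_add_right monomial_span.intros)
  qed
  have "monomial_span (lie_bracket W V)"
    using assms(1)
  proof (induction rule: monomial_span.induct)
    case (scaled c a)
    show ?case
      using monomial_span_scale [OF gen [OF assms(2)]] by (subst lie_bracket_swap)
  next
    case (add U V)
    then show ?case
      using assms(2) by (simp add: lie_bracket_add_right monomial_span.add)
  qed
  then show ?thesis
    by (subst lie_bracket_swap) (rule monomial_span_scale)
qed

lemma lie_subalgebra_monomial_span: "lie_subalgebra coord_prod {V. monomial_span V}"
proof -
  have "monomial_span (\<lambda>x. 0 :: complex^('a + 'a))"
    using monomial_span.scaled [of 0 "\<lambda>i. 0"] by simp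
  then show ?thesis
    unfolding lie_subalgebra_def
    by (auto intro: monomial_span_alg_vector_field monomial_span.add monomial_span_scale
        monomial_span_bracket)
qed

section \<open>Completeness\<close>

text \<open>Along the field the rate \<open>e\<^sub>i = c (J a)\<^sub>i x\<^sup>a\<close> at which \<open>ln x\<^sub>i\<close> changes is constant, since \<open>x\<^sup>a\<close>
  is a first integral. So the integral curves are
  translates of one-parameter subgroups of the torus, with the rates taken at the initial point.\<close>

lemma complete_monomial_field: "complete_field coord_prod (\<lambda>x. c *s monomial_field a x)"
  unfolding complete_field_def
proof
  fix x :: "complex^('a + 'a)" assume x: "x \<in> torus"
  define e where "e i = c * of_int (dual_exponent a i) * monomial a x" for i
  define \<phi> :: "complex \<Rightarrow> complex^('a + 'a)" where "\<phi> t = (\<chi> i. x $ i * exp (t * e i))" for t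
  have torus: "\<phi> t \<in> torus" for t
    using x by (simp add: \<phi>_def torus_iff)
  have first_integral: "monomial a (\<phi> t) = monomial a x" for t
  proof -
    have "monomial a (\<phi> t) = monomial a x * (\<Prod>i\<in>UNIV. exp (t * e i) powi a i)"
      by (simp add: monomial_def \<phi>_def power_int_mult_distrib prod.distrib)
    also have "(\<Prod>i\<in>UNIV. exp (t * e i) powi a i) = exp (\<Sum>i\<in>UNIV. of_int (a i) * (t * e i))"
      by (simp add: exp_sum exp_power_int mult_ac)
    also have "(\<Sum>i\<in>UNIV. of_int (a i) * (t * e i)) = t * c * monomial a x * of_int (pairing a a)"
      by (simp add: pairing_def e_def sum_distrib_left mult_ac)
    finally show ?thesis by (simp add: pairing_self)
  qed
  have "\<phi> 0 = x" by (simp add: \<phi>_def vec_eq_iff)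
  moreover have "((\<lambda>s. \<phi> s $ i) has_field_derivative (c *s monomial_field a (\<phi> t)) $ i) (at t)" for t i
  proof -
    have "(c *s monomial_field a (\<phi> t)) $ i = x $ i * (exp (t * e i) * e i)"
      by (simp add: monomial_field_def torus first_integral) (simp add: \<phi>_def e_def mult_ac)
    then show ?thesis
      unfolding \<phi>_def by (auto intro!: derivative_eq_intros)
  qed
  ultimately show "\<exists>\<phi>. \<phi> 0 = x \<and> (\<forall>t. \<phi> t \<in> torus \<and>
      (\<forall>i. ((\<lambda>s. \<phi> s $ i) has_field_derivative (c *s monomial_field a (\<phi> t)) $ i) (at t)))"
    using torus by blast
qed

theorem proposition3p3:
  shows "alg_hamiltonian_density_property
           (coord_prod :: complex^('n::finite + 'n) \<Rightarrow> complex) torus_form"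
proof -
  let ?G = "{V :: complex^('n + 'n) \<Rightarrow> _. monomial_span V \<and> complete_field coord_prod V}"
  have "lie_subalgebra coord_prod hull ?G \<subseteq> {V. monomial_span V}"
    by (rule hull_minimal) (auto intro: lie_subalgebra_monomial_span)
  moreover have "V \<in> L"
    if L: "lie_subalgebra coord_prod L" "?G \<subseteq> L" and "monomial_span V"
    for L and V :: "complex^('n + 'n) \<Rightarrow> _"
    using that(3)
  proof (induction rule: monomial_span.induct)
    case (scaled c a)
    then show ?case using L(2) complete_monomial_field monomial_span.scaled by blast
  next
    case (add V W)
    then show ?case using L(1) unfolding lie_subalgebra_def by blast
  qed
  then have "{V. monomial_span V} \<subseteq> lie_subalgebra coord_prod hull ?G"
    unfolding hull_def by blast
  ultimately show ?thesis
    unfolding alg_hamiltonian_density_property_def hamiltonian_fields_eq_span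
      mem_Collect_eq by (rule subset_antisym)
qed

end
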